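(* \[ ex(n;P_3;2) = (n/2)^{3} + O(n^2). \]
   Context: A digraph has a vertex set and an arc set consisting of ordered pairs of distinct vertices. A walk of length $\ell$ is a sequence $x_0x_1\dots x_\ell$ of vertices with $x_i \rightarrow x_{i+1}$ for all $i$. A digraph is $k$-geodetic if for every ordered pair $(u,v)$ of (not necessarily distinct) vertices there is at most one $u,v$-walk of length at most $k$. $P_3$ denotes the directed path of length $3$ (three arcs, four distinct vertices). For a digraph $Z$ and $k\ge 2$, $ex(n;Z;k)$ is the largest number of copies of $Z$ (subdigraphs isomorphic to $Z$) in a $k$-geodetic digraph with $n$ vertices. *)

theory Defs
  imports
    "Graph_Theory.Pair_Digraph"
    "Graph_Theory.Digraph_Isomorphism"
    "Graph_Theory.Vertex_Walk"
    "HOL-Library.Landau_Symbols"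
begin

text \<open>
  Walks may repeat vertices, and the case \<open>u = v\<close> is included: there the trivial walk
  \<open>[u]\<close> of length 0 is one of the walks counted.
\<close>

definition k_geodetic :: "nat \<Rightarrow> 'a pair_pre_digraph \<Rightarrow> bool" where
  "k_geodetic k G \<longleftrightarrow>
     (\<forall>u \<in> pverts G. \<forall>v \<in> pverts G.
        \<exists>\<^sub>\<le>\<^sub>1 p. vwalk p (with_proj G) \<and> hd p = u \<and> last p = v \<and> vwalk_length p \<le> k)"

definition copies :: "'b pair_pre_digraph \<Rightarrow> 'a pair_pre_digraph \<Rightarrow> 'a pair_pre_digraph set" where
  "copies Z G = {H. subgraph (with_proj H) (with_proj G) \<and> digraph_iso (with_proj Z) (with_proj H)}"

text \<open>
  Vertices are taken to be natural numbers; since every finite digraph is isomorphic to one of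
  this kind, this does not affect the maximum. The locale \<open>pair_digraph\<close> says: finite,
  loopless, arcs are pairs of vertices. Opposite arcs are allowed.
\<close>

definition geodetic_counts :: "nat \<Rightarrow> 'b pair_pre_digraph \<Rightarrow> nat \<Rightarrow> nat set" where
  "geodetic_counts n Z k =
     {card (copies Z G) | G :: nat pair_pre_digraph.
        pair_digraph G \<and> card (pverts G) = n \<and> k_geodetic k G}"

definition ex :: "nat \<Rightarrow> 'b pair_pre_digraph \<Rightarrow> nat \<Rightarrow> nat" where
  "ex n Z k = Max (geodetic_counts n Z k)"

text \<open>The directed path with \<open>l\<close> arcs, on the \<open>l + 1\<close> vertices \<open>0, \<dots>, l\<close>.\<close>

definition dipath :: "nat \<Rightarrow> nat pair_pre_digraph" where
  "dipath l = \<lparr> pverts = {0..l}, parcs = {(i, Suc i) | i. i < l} \<rparr>"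

abbreviation P3 :: "nat pair_pre_digraph" where
  "P3 \<equiv> dipath 3"


text \<open>The maximum defining \<open>ex\<close> is taken over a nonempty finite set.\<close>

lemma copies_finite_card:
  assumes "pair_digraph G"
  shows "finite (copies Z G)"
    and "card (copies Z G) \<le> 2 ^ card (pverts G) * 2 ^ (card (pverts G) * card (pverts G))"
proof -
  interpret pair_digraph G by fact
  let ?S = "Pow (pverts G) \<times> Pow (pverts G \<times> pverts G)"
  let ?f = "\<lambda>H :: 'a pair_pre_digraph. (pverts H, parcs H)"
  have fin: "finite ?S" using pair_finite_verts by auto
  have inj: "inj_on ?f (copies Z G)" by (auto intro!: inj_onI)
  have sub: "?f ` copies Z G \<subseteq> ?S"
    by (auto simp: copies_def subgraph_def dest: in_arcsD1 in_arcsD2)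
  show "finite (copies Z G)"
    using inj sub fin by (meson finite_imageD finite_subset)
  have "card (copies Z G) = card (?f ` copies Z G)"
    using inj by (simp add: card_image)
  also have "\<dots> \<le> card ?S" by (rule card_mono[OF fin sub])
  also have "\<dots> = 2 ^ card (pverts G) * 2 ^ (card (pverts G) * card (pverts G))"
    using pair_finite_verts by (simp add: card_cartesian_product card_Pow)
  finally show "card (copies Z G) \<le> 2 ^ card (pverts G) * 2 ^ (card (pverts G) * card (pverts G))" .
qed

lemma finite_geodetic_counts: "finite (geodetic_counts n Z k)"
proof (rule finite_subset)
  show "geodetic_counts n Z k \<subseteq> {..2 ^ n * 2 ^ (n * n)}"
    by (auto simp: geodetic_counts_def dest: copies_finite_card(2)[where Z = Z])
qed simp

lemma geodetic_counts_nonempty: "geodetic_counts n Z k \<noteq> {}"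
proof -
  let ?G = "\<lparr> pverts = {..<n}, parcs = {} \<rparr> :: nat pair_pre_digraph"
  have "pair_digraph ?G" by unfold_locales auto
  moreover have "\<exists>x. p = [x]" if "vwalk p (with_proj ?G)" for p
    using that by (cases p rule: vwalk_arcs.cases) (auto simp: vwalk_def)
  then have "k_geodetic k ?G"
    unfolding k_geodetic_def Uniq_def by (metis last_ConsL list.sel(1))
  ultimately have "card (copies Z ?G) \<in> geodetic_counts n Z k"
    unfolding geodetic_counts_def by force
  then show ?thesis by blast
qed

end

theory Submission
  imports Defs
begin

text \<open>
  Upper bound. Let \<open>i(b)\<close> be the in-degree of \<open>b\<close> and \<open>S(b)\<close> the number of walks of length 2
  from \<open>b\<close>. An arc lies in at most one triangle, so \<open>i(b) + S(b) \<le> n\<close>, and the number of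
  walks of length 3 is \<open>\<Sum>b. i(b) * S(b)\<close>. A vertex whose in- and out-degree are both
  below \<open>n / 8\<close> contributes at most \<open>n\<^sup>2 / 8\<close>. Since the product of in- and out-degree sums to at
  most \<open>n\<^sup>2\<close>, the vertices of small in-degree and large out-degree contribute \<open>O(n\<^sup>2)\<close> in
  total. All others contribute at most \<open>n\<^sup>2 / 4\<close> each. Averaging this estimate with the one for
  the reversed digraph counts every vertex with weight \<open>n\<^sup>2 / 8\<close>.

  Lower bound. Take two classes \<open>a\<^sub>i\<close>, \<open>b\<^sub>i\<close> of \<open>m = \<lfloor>n / 2\<rfloor>\<close> vertices
  with arcs \<open>a\<^sub>j \<rightarrow> b\<^sub>i\<close> for \<open>i \<noteq> j\<close> and \<open>b\<^sub>i \<rightarrow> a\<^sub>i\<close>; then every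
  \<open>a\<^sub>j b\<^sub>i a\<^sub>i b\<^sub>k\<close> with \<open>j, k \<noteq> i\<close> is a path.
\<close>

section \<open>Counting walks of length 3 in a relation\<close>

text \<open>The last three axioms exclude distinct walks with common ends of lengths 0 and 2, 1 and
  2, and 2 and 2; \<open>no_digon\<close> with \<open>u = v\<close> also excludes loops.\<close>

locale two_geodetic =
  fixes V :: "'a set" and E :: "'a rel"
  assumes finite_V: "finite V"
    and E_sub: "E \<subseteq> V \<times> V"
    and no_digon: "(u, v) \<in> E \<Longrightarrow> (v, u) \<notin> E"
    and no_shortcut: "(u, w) \<in> E \<Longrightarrow> (w, v) \<in> E \<Longrightarrow> (u, v) \<notin> E"
    and unique_midpoint:
      "(u, w) \<in> E \<Longrightarrow> (w, v) \<in> E \<Longrightarrow> (u, w') \<in> E \<Longrightarrow> (w', v) \<in> E \<Longrightarrow> w = w'"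

lemma two_geodetic_converse: "two_geodetic V E \<Longrightarrow> two_geodetic V (E\<inverse>)"
  unfolding two_geodetic_def by blast

text \<open>\<open>((b, c), (x, y))\<close> stands for the walk \<open>x b c y\<close>; triangles,
  where \<open>x = y\<close>, are counted too.\<close>

definition three_walks :: "'a rel \<Rightarrow> (('a \<times> 'a) \<times> 'a \<times> 'a) set" where
  "three_walks E = (SIGMA e:E. E\<inverse> `` {fst e} \<times> E `` {snd e})"

context two_geodetic
begin

lemma finite_E: "finite E"
  using E_sub finite_V by (meson finite_SigmaI finite_subset)

lemma finite_out: "finite (E `` {v})" and finite_in: "finite (E\<inverse> `` {v})"
  using finite_E by (auto intro: finite_Image)

lemma finite_three_walks: "finite (three_walks E)"
  unfolding three_walks_def using finite_E finite_out finite_in by blast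

lemma in_degree_plus_two_walks_le:
  "card (E\<inverse> `` {b}) + (\<Sum>c\<in>E `` {b}. card (E `` {c})) \<le> card V"
proof -
  let ?N = "E\<inverse> `` {b}"
  let ?Q = "SIGMA c:E `` {b}. E `` {c}"
  \<comment> \<open>An in-neighbour \<open>y\<close> of \<open>b\<close> reached by \<open>b \<rightarrow> c \<rightarrow> y\<close> closes a triangle; charge it to \<open>c\<close>.\<close>
  define f where "f = (\<lambda>(c, y). if y \<in> ?N then c else y)"
  \<comment> \<open>If only one of two equal values is charged, an out-neighbour of \<open>b\<close>
    ends a 2-walk from \<open>b\<close>, against \<open>no_shortcut\<close>. If both are,
    \<open>y\<close> is the unique midpoint between \<open>c\<close> and \<open>b\<close>.\<close>
  have inj: "inj_on f ?Q"
  proof (rule inj_onI)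
    fix p q assume "p \<in> ?Q" "q \<in> ?Q" "f p = f q"
    moreover obtain c y c' y' where "p = (c, y)" "q = (c', y')" by fastforce
    ultimately show "p = q"
      by (auto simp: f_def split: if_splits dest: no_shortcut intro: unique_midpoint)
  qed
  have disj: "f ` ?Q \<inter> ?N = {}"
    by (auto simp: f_def split: if_splits dest: no_digon)
  have "card ?N + card ?Q = card ?N + card (f ` ?Q)"
    using inj by (simp add: card_image)
  also have "\<dots> = card (?N \<union> f ` ?Q)"
    using disj finite_in finite_out by (subst card_Un_disjoint) auto
  also have "\<dots> \<le> card V"
    using E_sub by (intro card_mono finite_V) (auto simp: f_def)
  finally show ?thesis
    using finite_out by (simp add: card_SigmaI)
qed

text \<open>An in-neighbour and an out-neighbour of \<open>v\<close> determine \<open>v\<close> as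
  their midpoint.\<close>

lemma sum_in_degree_times_out_degree_le:
  "(\<Sum>v\<in>V. card (E\<inverse> `` {v}) * card (E `` {v})) \<le> (card V)\<^sup>2"
proof -
  let ?T = "SIGMA v:V. E\<inverse> `` {v} \<times> E `` {v}"
  have "(\<Sum>v\<in>V. card (E\<inverse> `` {v}) * card (E `` {v})) = card ?T"
    using finite_V finite_in finite_out by (simp add: card_SigmaI card_cartesian_product)
  also have "\<dots> = card (snd ` ?T)"
    by (intro card_image[symmetric]) (auto intro!: inj_onI intro: unique_midpoint)
  also have "\<dots> \<le> card (V \<times> V)"
    using E_sub finite_V by (intro card_mono) auto
  finally show ?thesis by (simp add: card_cartesian_product power2_eq_square)
qed

lemma card_three_walks:
  "card (three_walks E) =
     (\<Sum>b\<in>V. card (E\<inverse> `` {b}) * (\<Sum>c\<in>E `` {b}. card (E `` {c})))"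
proof -
  have E: "E = (SIGMA b:V. E `` {b})" using E_sub by auto
  have "card (three_walks E) = (\<Sum>e\<in>E. card (E\<inverse> `` {fst e}) * card (E `` {snd e}))"
    unfolding three_walks_def using finite_E finite_in finite_out
    by (simp add: card_SigmaI card_cartesian_product)
  also have "\<dots> = (\<Sum>e\<in>(SIGMA b:V. E `` {b}). card (E\<inverse> `` {fst e}) * card (E `` {snd e}))"
    using E by simp
  also have "\<dots> = (\<Sum>b\<in>V. \<Sum>c\<in>E `` {b}. card (E\<inverse> `` {b}) * card (E `` {c}))"
    using finite_V finite_out by (subst sum.Sigma) (auto simp: case_prod_unfold)
  finally show ?thesis by (simp add: sum_distrib_left)
qed

text \<open>The weights 2 and 1 are 8 times the shares 1/4 and 1/8 of a vertex in \<open>B\<close>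
  and \<open>P\<close>. The 64 covers all of \<open>A\<close> at once: 8 from scaling, 8 from the
  degree threshold.\<close>

lemma card_three_walks_one_sided:
  assumes V: "V = A \<union> B \<union> P" and disj: "A \<inter> B = {}" "A \<inter> P = {}" "B \<inter> P = {}"
    and A: "\<And>v. v \<in> A \<Longrightarrow> card V \<le> 8 * card (E `` {v})"
    and P: "\<And>v. v \<in> P \<Longrightarrow> 8 * card (E\<inverse> `` {v}) \<le> card V"
  shows "8 * card (three_walks E) \<le> (2 * card B + card P + 64) * (card V)\<^sup>2"
proof -
  define n where "n = card V"
  define i where "i v = card (E\<inverse> `` {v})" for v
  define S where "S v = (\<Sum>c\<in>E `` {v}. card (E `` {c}))" for v
  have fin: "finite A" "finite B" "finite P" using V finite_V by auto
  have iS: "i v + S v \<le> n" for v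
    unfolding i_def S_def n_def by (rule in_degree_plus_two_walks_le)
  have "8 * (i v * S v) \<le> 2 * n\<^sup>2" for v
  proof -
    have "4 * (int (i v) * int (S v)) \<le> (int (i v) + int (S v))\<^sup>2"
      using zero_le_power2[of "int (i v) - int (S v)"]
      by (simp add: power2_eq_square algebra_simps)
    then have "4 * (i v * S v) \<le> (i v + S v)\<^sup>2"
      by (metis (mono_tags) of_nat_add of_nat_le_iff of_nat_mult of_nat_numeral of_nat_power)
    also have "\<dots> \<le> n\<^sup>2" using iS by (intro power_mono) auto
    finally show ?thesis by linarith
  qed
  then have B_le: "(\<Sum>v\<in>B. 8 * (i v * S v)) \<le> card B * (2 * n\<^sup>2)"
    using sum_bounded_above[of B "\<lambda>v. 8 * (i v * S v)" "2 * n\<^sup>2"] by simp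
  have "8 * (i v * S v) \<le> n\<^sup>2" if "v \<in> P" for v
    using mult_mono[OF P[OF that], of "S v" n] iS[of v]
    by (simp add: i_def n_def power2_eq_square)
  then have P_le: "(\<Sum>v\<in>P. 8 * (i v * S v)) \<le> card P * n\<^sup>2"
    using sum_bounded_above[of P "\<lambda>v. 8 * (i v * S v)" "n\<^sup>2"] by simp
  \<comment> \<open>On \<open>A\<close> the out-degree can replace \<open>S v\<close>, which is at
    most \<open>n\<close>; the sum of degree products then applies.\<close>
  have "i v * S v \<le> 8 * (i v * card (E `` {v}))" if "v \<in> A" for v
  proof -
    have "S v \<le> 8 * card (E `` {v})" using iS[of v] A[OF that] by (simp add: n_def)
    then show ?thesis using mult_le_mono2[of "S v" "8 * card (E `` {v})" "i v"] by simp
  qed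
  then have "(\<Sum>v\<in>A. i v * S v) \<le> (\<Sum>v\<in>A. 8 * (i v * card (E `` {v})))"
    by (rule sum_mono)
  also have "\<dots> \<le> (\<Sum>v\<in>V. 8 * (i v * card (E `` {v})))"
    using V finite_V by (intro sum_mono2) auto
  also have "\<dots> \<le> 8 * n\<^sup>2"
    using sum_in_degree_times_out_degree_le by (simp add: i_def n_def sum_distrib_left[symmetric])
  finally have A_le: "(\<Sum>v\<in>A. 8 * (i v * S v)) \<le> 64 * n\<^sup>2"
    by (simp add: sum_distrib_left[symmetric])
  have "8 * card (three_walks E) = (\<Sum>v\<in>V. 8 * (i v * S v))"
    by (simp add: card_three_walks i_def S_def sum_distrib_left)
  also have "\<dots> = (\<Sum>v\<in>A. 8 * (i v * S v)) + (\<Sum>v\<in>B. 8 * (i v * S v)) + (\<Sum>v\<in>P. 8 * (i v * S v))"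
    unfolding V using fin disj by (simp add: sum.union_disjoint Int_Un_distrib2)
  finally show ?thesis
    using A_le B_le P_le by (simp add: n_def algebra_simps)
qed

end

text \<open>Reversing \<open>x b c y\<close> to \<open>y c b x\<close> swaps both pairs and is its
  own inverse.\<close>

lemma card_three_walks_converse: "card (three_walks (E\<inverse>)) = card (three_walks E)"
  by (rule bij_betw_same_card[of "\<lambda>(e, z). (prod.swap e, prod.swap z)"],
      rule bij_betw_byWitness[where f' = "\<lambda>(e, z). (prod.swap e, prod.swap z)"])
    (auto simp: three_walks_def)

lemma (in two_geodetic) card_three_walks_le:
  "8 * card (three_walks E) \<le> card V ^ 3 + 64 * (card V)\<^sup>2"
proof -
  let ?n = "card V"
  \<comment> \<open>Vertices with both degrees large go to \<open>B\<close>. For the converse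
    relation \<open>A\<close> and \<open>B\<close> exchange roles.\<close>
  define B where "B = {v \<in> V. ?n \<le> 8 * card (E\<inverse> `` {v})}"
  define A where "A = {v \<in> V - B. ?n \<le> 8 * card (E `` {v})}"
  define P where "P = V - A - B"
  have V: "V = A \<union> B \<union> P" "V = B \<union> A \<union> P" and disj: "A \<inter> B = {}" "A \<inter> P = {}" "B \<inter> P = {}"
    by (auto simp: A_def B_def P_def)
  have "8 * card (three_walks E) \<le> (2 * card B + card P + 64) * ?n\<^sup>2"
    using disj by (intro card_three_walks_one_sided[OF V(1)]) (auto simp: A_def B_def P_def)
  moreover have "8 * card (three_walks (E\<inverse>)) \<le> (2 * card A + card P + 64) * ?n\<^sup>2"
    using disj
    by (intro two_geodetic.card_three_walks_one_sided[OF two_geodetic_converse[OF two_geodetic_axioms] V(2)])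
      (auto simp: A_def B_def P_def)
  moreover have "?n = card A + card B + card P"
  proof -
    have "finite A" "finite B" "finite P" using finite_V by (simp_all add: A_def B_def P_def)
    then have "card (A \<union> B \<union> P) = card A + card B + card P"
      using disj by (simp add: card_Un_disjoint Int_Un_distrib2)
    then show ?thesis using V(1) by argo
  qed
  \<comment> \<open>Over the two estimates every vertex has total weight 2: \<open>2 + 0\<close> on
    \<open>B\<close>, \<open>0 + 2\<close> on \<open>A\<close>, \<open>1 + 1\<close> on
    \<open>P\<close>.\<close>
  ultimately have "16 * card (three_walks E) \<le> (2 * ?n + 128) * ?n\<^sup>2"
    by (simp add: card_three_walks_converse algebra_simps)
  then show ?thesis by (simp add: power2_eq_square power3_eq_cube algebra_simps)
qed

section \<open>From 2-geodetic digraphs to relations\<close>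

lemma k_geodetic_2_iff:
  assumes "pair_digraph G"
  shows "k_geodetic 2 G \<longleftrightarrow> two_geodetic (pverts G) (parcs G)"
proof
  interpret pair_digraph G by fact
  note vs = in_arcsD1 in_arcsD2
  {
    assume geo: "k_geodetic 2 G"
    \<comment> \<open>A walk of length at most 2 lists at most 3 vertices.\<close>
    have unique: "p = q"
      if "vwalk p (with_proj G)" "vwalk q (with_proj G)" "hd p = hd q" "last p = last q"
        "length p \<le> 3" "length q \<le> 3" for p q
    proof -
      have "hd p \<in> pverts G" "last p \<in> pverts G" using that(1) by (auto simp: vwalk_def)
      then show ?thesis using geo that unfolding k_geodetic_def Uniq_def by simp
    qed
    have walk: "vwalk [u] (with_proj G)" "vwalk [u, v] (with_proj G)"
      if "(u, v) \<in> parcs G" for u v using that vs by (auto simp: vwalk_def)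
    have walk2: "vwalk [u, w, v] (with_proj G)"
      if "(u, w) \<in> parcs G" "(w, v) \<in> parcs G" for u w v using that vs by (auto simp: vwalk_def)
    show "two_geodetic (pverts G) (parcs G)"
    proof
      fix u v assume "(u, v) \<in> parcs G"
      then show "(v, u) \<notin> parcs G" using unique[of "[u]" "[u, v, u]"] walk(1) walk2 by force
    next
      fix u w v assume "(u, w) \<in> parcs G" "(w, v) \<in> parcs G"
      then show "(u, v) \<notin> parcs G" using unique[of "[u, v]" "[u, w, v]"] walk(2) walk2 by force
    next
      fix u w v w'
      assume "(u, w) \<in> parcs G" "(w, v) \<in> parcs G" "(u, w') \<in> parcs G" "(w', v) \<in> parcs G"
      then show "w = w'" using unique[of "[u, w, v]" "[u, w', v]"] walk2 by force
    qed (use vs in \<open>auto simp: pair_finite_verts\<close>)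
  }
  {
    assume "two_geodetic (pverts G) (parcs G)"
    then interpret two_geodetic "pverts G" "parcs G" .
    have short: "(\<exists>x. p = [x]) \<or> (\<exists>x y. p = [x, y] \<and> (x, y) \<in> parcs G) \<or>
        (\<exists>x y z. p = [x, y, z] \<and> (x, y) \<in> parcs G \<and> (y, z) \<in> parcs G)"
      if "vwalk p (with_proj G)" "vwalk_length p \<le> 2" for p
    proof -
      have "p \<noteq> []" "length p \<le> 3" using that by (auto simp: vwalk_def)
      then consider x where "p = [x]" | x y where "p = [x, y]" | x y z where "p = [x, y, z]"
        by (auto simp: neq_Nil_conv le_Suc_eq numeral_3_eq_3 length_Suc_conv)
      then show ?thesis using that(1) by cases (auto simp: vwalk_def)
    qed
    have "p = q"
      if "vwalk p (with_proj G)" "vwalk q (with_proj G)" "hd p = hd q" "last p = last q"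
        "vwalk_length p \<le> 2" "vwalk_length q \<le> 2" for p q
      using short[OF that(1,5)] short[OF that(2,6)] that(3,4)
      by (elim disjE exE conjE; simp; metis no_digon no_shortcut unique_midpoint)
    then show "k_geodetic 2 G"
      unfolding k_geodetic_def Uniq_def by simp
  }
qed

section \<open>Copies of the path as vertex quadruples\<close>

definition path3 :: "'a \<Rightarrow> 'a \<Rightarrow> 'a \<Rightarrow> 'a \<Rightarrow> 'a pair_pre_digraph" where
  "path3 x b c y = \<lparr> pverts = {x, b, c, y}, parcs = {(x, b), (b, c), (c, y)} \<rparr>"

lemma path3_inject:
  assumes "distinct [x, b, c, y]" "path3 x b c y = path3 x' b' c' y'"
  shows "x = x' \<and> b = b' \<and> c = c' \<and> y = y'"
proof -
  have E: "{(x, b), (b, c), (c, y)} = {(x', b'), (b', c'), (c', y')}"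
    using assms(2) by (simp add: path3_def)
  have arcs: "(x', b') \<in> {(x, b), (b, c), (c, y)}" "(b', c') \<in> {(x, b), (b, c), (c, y)}"
    "(c', y') \<in> {(x, b), (b, c), (c, y)}"
    unfolding E by simp_all
  \<comment> \<open>No arc enters \<open>x\<close>, so \<open>(x, b)\<close> can only be the first
    arc of the other path.\<close>
  have "(x, b) \<in> {(x', b'), (b', c'), (c', y')}" unfolding E[symmetric] by simp
  then have "x = x'" using arcs(1,2) assms(1) by auto
  moreover from this have "b = b'" using arcs(1) assms(1) by auto
  moreover from this have "c = c'" using arcs(2) assms(1) by auto
  moreover from this have "y = y'" using arcs(3) assms(1) by auto
  ultimately show ?thesis by simp
qed

lemma dipath_3: "P3 = \<lparr> pverts = {0, 1, 2, 3}, parcs = {(0, 1), (1, 2), (2, 3)} \<rparr>"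
  by (auto simp: dipath_def)

lemma digraph_iso_P3_iff:
  "digraph_iso (with_proj P3) (with_proj H) \<longleftrightarrow>
     (\<exists>x b c y. distinct [x, b, c, y] \<and> H = path3 x b c y)"
proof
  assume "digraph_iso (with_proj P3) (with_proj H)"
  then obtain f where f: "pre_digraph.digraph_isomorphism (with_proj P3) f"
    and H: "with_proj H = app_iso f (with_proj P3)"
    unfolding digraph_iso_def by blast
  let ?v = "iso_verts f"
  have inj: "inj_on ?v {0, 1, 2, 3}"
    and arc: "\<And>a. a \<in> {(0, 1), (1, 2), (2, 3)} \<Longrightarrow>
      ?v (fst a) = iso_tail f (iso_arcs f a) \<and> ?v (snd a) = iso_head f (iso_arcs f a)"
    using f by (auto simp: pre_digraph.digraph_isomorphism_def dipath_3)
  have proj: "pverts H = verts (with_proj H)" "parcs H = arcs (with_proj H)"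
    "tail (with_proj H) = fst" "head (with_proj H) = snd" by simp_all
  \<comment> \<open>Tail and head in the image are the projections, so the vertex map forces the arc
    map.\<close>
  have "iso_tail f = fst" "iso_head f = snd"
    using proj(3,4) unfolding H by simp_all
  then have "iso_arcs f (0, 1) = (?v 0, ?v 1)" "iso_arcs f (1, 2) = (?v 1, ?v 2)"
    "iso_arcs f (2, 3) = (?v 2, ?v 3)"
    using arc[of "(0, 1)"] arc[of "(1, 2)"] arc[of "(2, 3)"] by (simp_all add: prod_eq_iff)
  then have "H = path3 (?v 0) (?v 1) (?v 2) (?v 3)"
    using proj(1,2) unfolding H by (simp add: path3_def dipath_3)
  moreover have "distinct [?v 0, ?v 1, ?v 2, ?v 3]"
    using inj by (auto simp: inj_on_def)
  ultimately show "\<exists>x b c y. distinct [x, b, c, y] \<and> H = path3 x b c y" by blast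
next
  assume "\<exists>x b c y. distinct [x, b, c, y] \<and> H = path3 x b c y"
  then obtain x b c y where d: "distinct [x, b, c, y]" and H: "H = path3 x b c y" by blast
  define v where "v = (\<lambda>i::nat. [x, b, c, y] ! i)"
  have v: "v 0 = x" "v 1 = b" "v (Suc 0) = b" "v 2 = c" "v 3 = y"
    by (auto simp: v_def numeral_2_eq_2 numeral_3_eq_3)
  define f where "f = \<lparr> iso_verts = v, iso_arcs = map_prod v v, iso_head = snd, iso_tail = fst \<rparr>"
  have "pre_digraph.digraph_isomorphism (with_proj P3) f"
    unfolding pre_digraph.digraph_isomorphism_def wf_digraph_def
    using d by (auto simp: f_def dipath_3 v)
  moreover have "with_proj H = app_iso f (with_proj P3)"
    unfolding H path3_def dipath_3 with_proj_def app_iso_def f_def by (simp add: v)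
  ultimately show "digraph_iso (with_proj P3) (with_proj H)"
    unfolding digraph_iso_def by blast
qed

lemma (in pair_wf_digraph) copies_P3:
  "copies P3 G = {path3 x b c y | x b c y.
     distinct [x, b, c, y] \<and> (x, b) \<in> parcs G \<and> (b, c) \<in> parcs G \<and> (c, y) \<in> parcs G}"
proof -
  have "wf_digraph (with_proj G)" by unfold_locales
  then have "subgraph (with_proj (path3 x b c y)) (with_proj G) \<longleftrightarrow>
      (x, b) \<in> parcs G \<and> (b, c) \<in> parcs G \<and> (c, y) \<in> parcs G" for x b c y
    by (auto simp: subgraph_def compatible_def wf_digraph_def path3_def
        dest: in_arcsD1 in_arcsD2)
  then show ?thesis
    unfolding copies_def digraph_iso_P3_iff by blast
qed

text \<open>Every copy comes from a walk of length 3; triangles only enlarge the image, so an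
  inclusion suffices.\<close>

lemma card_copies_P3_le:
  assumes "pair_digraph G" "k_geodetic 2 G"
  shows "8 * card (copies P3 G) \<le> card (pverts G) ^ 3 + 64 * (card (pverts G))\<^sup>2"
proof -
  interpret pair_digraph G by fact
  interpret two_geodetic "pverts G" "parcs G"
    using assms k_geodetic_2_iff by blast
  let ?f = "\<lambda>((b, c), x, y). path3 x b c y"
  have "copies P3 G \<subseteq> ?f ` three_walks (parcs G)"
    unfolding copies_P3 by (force simp: three_walks_def)
  then have "card (copies P3 G) \<le> card (three_walks (parcs G))"
    using finite_three_walks by (meson card_image_le card_mono finite_imageI le_trans)
  then show ?thesis
    using card_three_walks_le by linarith
qed

section \<open>The extremal construction\<close>

text \<open>The vertices \<open>i\<close> and \<open>m + i\<close>, for \<open>i < m\<close>, play the roles of \<open>a\<^sub>i\<close> and \<open>b\<^sub>i\<close>.\<close>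

definition crown :: "nat \<Rightarrow> nat \<Rightarrow> nat pair_pre_digraph" where
  "crown n m = \<lparr> pverts = {..<n},
     parcs = {(j, m + i) | i j. i < m \<and> j < m \<and> i \<noteq> j} \<union> {(m + i, i) | i. i < m} \<rparr>"

text \<open>Arcs change class, and a 2-walk joins distinct vertices of one class. Its midpoint is
  forced: \<open>b_i\<close> on the way to \<open>a_i\<close>, and \<open>a_i\<close> on the way
  from \<open>b_i\<close>.\<close>

lemma
  assumes "2 * m \<le> n"
  shows pair_digraph_crown: "pair_digraph (crown n m)"
    and k_geodetic_crown: "k_geodetic 2 (crown n m)"
    and card_copies_P3_crown: "m * (m - 1)\<^sup>2 \<le> card (copies P3 (crown n m))"
proof -
  show dg: "pair_digraph (crown n m)"
  proof
    have "parcs (crown n m) \<subseteq> {..<n} \<times> {..<n}" using assms by (auto simp: crown_def)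
    then show "finite (parcs (crown n m))" by (rule finite_subset) simp
  qed (use assms in \<open>auto simp: crown_def\<close>)
  then interpret pair_digraph "crown n m" .
  show "k_geodetic 2 (crown n m)"
    unfolding k_geodetic_2_iff[OF dg] using assms
    by unfold_locales (auto simp: crown_def)
  \<comment> \<open>\<open>i\<close> names the middle arc from \<open>b_i\<close> to
    \<open>a_i\<close>; \<open>j = k\<close> is allowed, as \<open>a_j\<close> and
    \<open>b_j\<close> differ.\<close>
  define S where "S = (SIGMA i:{..<m}. ({..<m} - {i}) \<times> ({..<m} - {i}))"
  define f where "f = (\<lambda>(i, j, k). path3 j (m + i) i (m + k))"
  have d: "distinct [j, m + i, i, m + k]" if "(i, j, k) \<in> S" for i j k
    using that by (auto simp: S_def)
  have "inj_on f S"
  proof (rule inj_onI)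
    fix p q assume p: "p \<in> S" and "q \<in> S" "f p = f q"
    obtain i j k i' j' k' where "p = (i, j, k)" "q = (i', j', k')" by (metis prod_cases3)
    with p \<open>f p = f q\<close> show "p = q"
      using path3_inject[OF d[of i j k], of j' "m + i'" i' "m + k'"] by (auto simp: f_def)
  qed
  moreover have "f ` S \<subseteq> copies P3 (crown n m)"
  proof (rule image_subsetI)
    fix p assume "p \<in> S"
    moreover obtain i j k where p: "p = (i, j, k)" by (metis prod_cases3)
    ultimately have "(j, m + i) \<in> parcs (crown n m)" "(m + i, i) \<in> parcs (crown n m)"
      "(i, m + k) \<in> parcs (crown n m)" "distinct [j, m + i, i, m + k]"
      using d[of i j k] by (auto simp: S_def crown_def)
    then show "f p \<in> copies P3 (crown n m)"
      unfolding copies_P3 p f_def prod.case by blast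
  qed
  moreover have "card S = m * (m - 1)\<^sup>2"
    by (simp add: S_def card_SigmaI card_cartesian_product power2_eq_square)
  ultimately show "m * (m - 1)\<^sup>2 \<le> card (copies P3 (crown n m))"
    using card_inj_on_le copies_finite_card(1)[OF dg] by metis
qed

section \<open>Bounds for the maximum and the asymptotics\<close>

lemma ex_P3_upper: "8 * ex n P3 2 \<le> n ^ 3 + 64 * n\<^sup>2"
proof -
  have "ex n P3 2 \<in> geodetic_counts n P3 2"
    unfolding ex_def by (intro Max_in finite_geodetic_counts geodetic_counts_nonempty)
  then obtain G :: "nat pair_pre_digraph" where
    "ex n P3 2 = card (copies P3 G)" "pair_digraph G" "card (pverts G) = n" "k_geodetic 2 G"
    unfolding geodetic_counts_def by blast
  then show ?thesis using card_copies_P3_le[of G] by simp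
qed

lemma ex_P3_lower:
  assumes "2 * m \<le> n"
  shows "m * (m - 1)\<^sup>2 \<le> ex n P3 2"
proof -
  have "card (copies P3 (crown n m)) \<in> geodetic_counts n P3 2"
    unfolding geodetic_counts_def
    using pair_digraph_crown[OF assms] k_geodetic_crown[OF assms]
    by (force simp: crown_def)
  then have "card (copies P3 (crown n m)) \<le> ex n P3 2"
    unfolding ex_def by (intro Max_ge finite_geodetic_counts)
  then show ?thesis using card_copies_P3_crown[OF assms] by linarith
qed

theorem theorem32:
  shows "(\<lambda>n. real (ex n P3 2) - (real n / 2) ^ 3) \<in> O[at_top](\<lambda>n. real n ^ 2)"
proof (rule bigoI[where c = 8])
  show "\<forall>\<^sub>F n in at_top. norm (real (ex n P3 2) - (real n / 2) ^ 3) \<le> 8 * norm (real n ^ 2)"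
    \<comment> \<open>From 3 on, \<open>x - 3 / 2\<close> is nonnegative, which makes squaring it
      monotone.\<close>
    using eventually_ge_at_top[of 3]
  proof eventually_elim
    fix n :: nat assume n: "3 \<le> n"
    define m where "m = n div 2"
    define x where "x = real n / 2"
    have "8 * real (ex n P3 2) \<le> real n ^ 3 + 64 * real n ^ 2"
      using ex_P3_upper[of n] by (metis (mono_tags) of_nat_add of_nat_le_iff of_nat_mult of_nat_numeral of_nat_power)
    \<comment> \<open>The constant 8 is \<open>64 / 8\<close>.\<close>
    then have "real (ex n P3 2) - x ^ 3 \<le> 8 * real n ^ 2"
      by (simp add: x_def power_divide)
    moreover have "x ^ 3 - real (ex n P3 2) \<le> 8 * real n ^ 2"
    proof -
      have m: "x - 1 / 2 \<le> real m" "1 \<le> m" using n by (auto simp: x_def m_def)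
      \<comment> \<open>The factors bound \<open>m\<close> and \<open>m - 1\<close> from below. The
        true coefficient \<open>- 7 / 2\<close> of \<open>x ^ 2\<close> is relaxed to
        \<open>- 4\<close>, as \<open>4 * x ^ 2\<close> is \<open>n ^ 2\<close>.\<close>
      have "x ^ 3 - 4 * x ^ 2 \<le> (x - 1 / 2) * (x - 3 / 2) ^ 2"
      proof -
        have "1 \<le> x" using n by (simp add: x_def)
        moreover have "(x - 1 / 2) * (x - 3 / 2) ^ 2 = x ^ 3 - 4 * x ^ 2 + (x ^ 2 / 2 + 15 / 4 * x - 9 / 8)"
          by (simp add: power2_eq_square power3_eq_cube field_simps)
        ultimately show ?thesis using zero_le_power2[of x] by linarith
      qed
      also have "\<dots> \<le> real m * (real m - 1) ^ 2"
        using m n by (intro mult_mono power_mono) (auto simp: x_def)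
      also have "\<dots> = real (m * (m - 1)\<^sup>2)" using m(2) by (simp add: of_nat_diff)
      also have "\<dots> \<le> real (ex n P3 2)"
        unfolding of_nat_le_iff by (rule ex_P3_lower) (simp add: m_def)
      finally have "x ^ 3 - 4 * x ^ 2 \<le> real (ex n P3 2)" .
      moreover have "4 * x ^ 2 = real n ^ 2" by (simp add: x_def power_divide)
      ultimately show ?thesis using zero_le_power2[of "real n"] by linarith
    qed
    ultimately show "norm (real (ex n P3 2) - (real n / 2) ^ 3) \<le> 8 * norm (real n ^ 2)"
      by (simp add: x_def abs_le_iff)
  qed
qed

end
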